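(* Let $\alpha\in(0,1)$. Let $E_1,E_2\subset\mathbb{R}^d$ be sets of finite fractional perimeter $\mathbb{P}_\alpha$ and let $E=E_1\cup E_2$ with $|E_1\cap E_2|=0$ and $|E_1|,|E_2|>0$. Then $$\mathbb{P}_\alpha(E)=\mathbb{P}_\alpha(E_1\cup E_2)<\mathbb{P}_\alpha(E_1)+\mathbb{P}_\alpha(E_2).$$
   Context: For measurable $E\subset\mathbb{R}^d$ the fractional perimeter is $$\mathbb{P}_\alpha(E):=\int_{\mathbb{R}^d}\int_{\mathbb{R}^d}\frac{|\mathbf{1}_E(x)-\mathbf{1}_E(y)|}{|x-y|^{d+\alpha}}\,dx\,dy .$$ $|\cdot|$ of a set denotes Lebesgue measure. *)

theory Defs
  imports "HOL-Analysis.Analysis"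
begin

text \<open>The fractional perimeter of \<open>E\<close>, with values in \<open>[0, \<infinity>]\<close>.  The convention \<open>0 / 0 = 0\<close>
  on the diagonal \<open>x = y\<close> is harmless, since for each \<open>x\<close> the diagonal is a null set in \<open>y\<close>.\<close>

definition frac_perimeter :: "real \<Rightarrow> (real ^ 'd) set \<Rightarrow> ennreal" where
  "frac_perimeter \<alpha> E =
    (\<integral>\<^sup>+ x. (\<integral>\<^sup>+ y. ennreal (\<bar>indicat_real E x - indicat_real E y\<bar>
        / norm (x - y) powr (real CARD('d) + \<alpha>)) \<partial>lebesgue) \<partial>lebesgue)"

end

theory Submission
  imports Defs
begin

text \<open>For disjoint sets \<open>A\<close> and \<open>B\<close>, a pair \<open>(x, y)\<close> is separated by \<open>A\<close> and also by \<open>B\<close> exactly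
  when one point lies in \<open>A\<close> and the other in \<open>B\<close>; such a pair is not separated by \<open>A \<union> B\<close>.  Every
  other pair contributes equally to \<open>P(A \<union> B)\<close> and to \<open>P(A) + P(B)\<close>.  So the sum of the two
  perimeters exceeds the perimeter of the union by twice the interaction energies of \<open>A\<close> with \<open>B\<close>
  and of \<open>B\<close> with \<open>A\<close> (lemma \<open>frac_perimeter_disjoint_Un\<close>).  The kernel is strictly positive off
  the diagonal, so these energies are positive as soon as both sets have positive measure (lemma
  \<open>frac_interaction_pos\<close>), and finiteness of the perimeters makes the inequality strict.

  The identity between the perimeters needs disjoint sets, while \<open>E1\<close> and \<open>E2\<close> may share a null set.
  The perimeter sees sets only up to null sets (lemma \<open>frac_perimeter_cong_AE\<close>), so \<open>E1\<close> and \<open>E2\<close>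
  may be replaced by disjoint Borel sets; the integrands are then Borel functions of the pair
  \<open>(x, y)\<close>, and iterated integrals split over sums.\<close>

text \<open>For Borel sets, Tonelli's theorem makes this symmetric in \<open>A\<close> and \<open>B\<close>.  Below, both orders appear side by
  side instead, because only the positivity of the two terms matters.\<close>

definition frac_interaction :: "real \<Rightarrow> (real ^ 'd) set \<Rightarrow> (real ^ 'd) set \<Rightarrow> ennreal" where
  "frac_interaction \<alpha> A B =
    (\<integral>\<^sup>+ x. (\<integral>\<^sup>+ y. ennreal (indicat_real A x * indicat_real B y
        / norm (x - y) powr (real CARD('d) + \<alpha>)) \<partial>lborel) \<partial>lborel)"

lemma frac_perimeter_lborel:
  fixes E :: "(real ^ 'd) set"
  shows "frac_perimeter \<alpha> E =
    (\<integral>\<^sup>+ x. (\<integral>\<^sup>+ y. ennreal (\<bar>indicat_real E x - indicat_real E y\<bar>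
        / norm (x - y) powr (real CARD('d) + \<alpha>)) \<partial>lborel) \<partial>lborel)"
  unfolding frac_perimeter_def by (simp add: nn_integral_completion)

text \<open>Changing \<open>E\<close> on a null set changes the inner integrand, for each good \<open>x\<close>, only at a null set
  of \<open>y\<close>, and the bad \<open>x\<close> are negligible for the outer integral.\<close>

lemma frac_perimeter_cong_AE:
  fixes E A :: "(real ^ 'd) set"
  assumes "AE x in lborel. x \<in> E \<longleftrightarrow> x \<in> A"
  shows "frac_perimeter \<alpha> E = frac_perimeter \<alpha> A"
proof -
  have eq: "AE x in lborel. indicat_real E x = indicat_real A x"
    using assms by eventually_elim (simp add: indicator_def)
  show ?thesis
    unfolding frac_perimeter_lborel
  proof (rule nn_integral_cong_AE)
    show "AE x in lborel.
        (\<integral>\<^sup>+ y. ennreal (\<bar>indicat_real E x - indicat_real E y\<bar>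
          / norm (x - y) powr (real CARD('d) + \<alpha>)) \<partial>lborel) =
        (\<integral>\<^sup>+ y. ennreal (\<bar>indicat_real A x - indicat_real A y\<bar>
          / norm (x - y) powr (real CARD('d) + \<alpha>)) \<partial>lborel)"
      using eq
    proof eventually_elim
      case (elim x)
      show ?case
        by (rule nn_integral_cong_AE) (use eq in eventually_elim, simp add: elim)
    qed
  qed
qed

lemma lebesgue_set_AE_eq_borel:
  fixes E :: "'a::euclidean_space set"
  assumes "E \<in> sets lebesgue"
  obtains A where "A \<in> sets borel" "AE x in lborel. x \<in> E \<longleftrightarrow> x \<in> A"
proof -
  from assms obtain S N N' where *: "E = S \<union> N" "N \<subseteq> N'" "N' \<in> null_sets lborel" "S \<in> sets lborel"
    by (rule sets_completionE)
  have "AE x in lborel. x \<notin> N'"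
    using *(3) by (rule AE_not_in)
  then have "AE x in lborel. x \<in> E \<longleftrightarrow> x \<in> S"
    by eventually_elim (use * in auto)
  with * that show thesis by simp
qed

text \<open>The integrands already agree pair by pair.  The factor \<open>2\<close> arises because a pair with one
  point in each set counts once in each perimeter and not at all in that of the union, but in only
  one of the two interactions.\<close>

lemma frac_perimeter_disjoint_Un:
  fixes A B :: "(real ^ 'd) set"
  assumes [measurable]: "A \<in> sets borel" "B \<in> sets borel" and disj: "A \<inter> B = {}"
  shows "frac_perimeter \<alpha> A + frac_perimeter \<alpha> B =
    frac_perimeter \<alpha> (A \<union> B) + 2 * (frac_interaction \<alpha> A B + frac_interaction \<alpha> B A)"
proof -
  define K where "K x y = norm (x - y) powr (real CARD('d) + \<alpha>)" for x y :: "real ^ 'd"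
  define p where "p S x y = ennreal (\<bar>indicat_real S x - indicat_real S y\<bar> / K x y)"
    for S and x y :: "real ^ 'd"
  define q where "q S T x y = ennreal (indicat_real S x * indicat_real T y / K x y)"
    for S T and x y :: "real ^ 'd"
  have [measurable]: "p S x \<in> borel_measurable lborel"
      "(\<lambda>x. \<integral>\<^sup>+ y. p S x y \<partial>lborel) \<in> borel_measurable lborel"
    if [measurable]: "S \<in> sets borel" for S x
    unfolding p_def K_def by measurable
  have [measurable]: "q S T x \<in> borel_measurable lborel"
      "(\<lambda>x. \<integral>\<^sup>+ y. q S T x y \<partial>lborel) \<in> borel_measurable lborel"
    if [measurable]: "S \<in> sets borel" "T \<in> sets borel" for S T x
    unfolding q_def K_def by measurable
  have pointwise: "p A x y + p B x y = p (A \<union> B) x y + 2 * (q A B x y + q B A x y)" for x y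
  proof -
    have "x \<notin> A \<or> x \<notin> B" "y \<notin> A \<or> y \<notin> B"
      using disj by auto
    then show ?thesis
      by (cases "x \<in> A"; cases "x \<in> B"; cases "y \<in> A"; cases "y \<in> B")
        (simp_all add: p_def q_def mult_2)
  qed
  have "(\<integral>\<^sup>+ x. \<integral>\<^sup>+ y. p A x y \<partial>lborel \<partial>lborel) + (\<integral>\<^sup>+ x. \<integral>\<^sup>+ y. p B x y \<partial>lborel \<partial>lborel)
      = (\<integral>\<^sup>+ x. \<integral>\<^sup>+ y. p A x y + p B x y \<partial>lborel \<partial>lborel)"
    by (simp add: nn_integral_add)
  also have "\<dots> = (\<integral>\<^sup>+ x. \<integral>\<^sup>+ y. p (A \<union> B) x y + 2 * (q A B x y + q B A x y) \<partial>lborel \<partial>lborel)"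
    by (simp only: pointwise)
  also have "\<dots> = (\<integral>\<^sup>+ x. \<integral>\<^sup>+ y. p (A \<union> B) x y \<partial>lborel \<partial>lborel)
      + 2 * ((\<integral>\<^sup>+ x. \<integral>\<^sup>+ y. q A B x y \<partial>lborel \<partial>lborel) + (\<integral>\<^sup>+ x. \<integral>\<^sup>+ y. q B A x y \<partial>lborel \<partial>lborel))"
    by (simp add: nn_integral_add nn_integral_cmult)
  finally show ?thesis
    unfolding frac_perimeter_lborel frac_interaction_def p_def q_def K_def .
qed

text \<open>The integrand is positive at every pair in \<open>A \<times> B\<close>: disjointness keeps such pairs off the
  diagonal, where division by zero would make it vanish.  A zero energy would therefore force,
  for almost every \<open>x\<close> in \<open>A\<close>, almost every \<open>y\<close> to lie outside \<open>B\<close>.\<close>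

lemma frac_interaction_pos:
  fixes A B :: "(real ^ 'd) set"
  assumes [measurable]: "A \<in> sets borel" "B \<in> sets borel" and disj: "A \<inter> B = {}"
    and posA: "emeasure lborel A > 0" and posB: "emeasure lborel B > 0"
  shows "frac_interaction \<alpha> A B > 0"
proof (rule ccontr)
  define q where "q x y = ennreal (indicat_real A x * indicat_real B y
      / norm (x - y) powr (real CARD('d) + \<alpha>))" for x y :: "real ^ 'd"
  have [measurable]: "q x \<in> borel_measurable lborel"
      "(\<lambda>x. \<integral>\<^sup>+ y. q x y \<partial>lborel) \<in> borel_measurable lborel" for x
    unfolding q_def by measurable
  have null_iff: "emeasure lborel S = 0 \<longleftrightarrow> (AE x in lborel. x \<notin> S)"
    if "S \<in> sets borel" for S :: "(real ^ 'd) set"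
    using that by (subst AE_iff_measurable[where N = S]) auto
  assume "\<not> frac_interaction \<alpha> A B > 0"
  then have "(\<integral>\<^sup>+ x. \<integral>\<^sup>+ y. q x y \<partial>lborel \<partial>lborel) = 0"
    by (simp add: frac_interaction_def q_def)
  then have "AE x in lborel. (\<integral>\<^sup>+ y. q x y \<partial>lborel) = 0"
    by (subst (asm) nn_integral_0_iff_AE) auto
  then have "AE x in lborel. x \<notin> A"
  proof eventually_elim
    case (elim x)
    then have *: "AE y in lborel. q x y = 0"
      by (subst (asm) nn_integral_0_iff_AE) auto
    show ?case
    proof
      assume "x \<in> A"
      from * have "AE y in lborel. y \<notin> B"
      proof eventually_elim
        case (elim y)
        show ?case
        proof
          assume "y \<in> B"
          with \<open>x \<in> A\<close> disj have "x \<noteq> y" by auto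
          with \<open>x \<in> A\<close> \<open>y \<in> B\<close> have "q x y > 0"
            by (simp add: q_def)
          with elim show False by simp
        qed
      qed
      with null_iff[of B] posB show False by simp
    qed
  qed
  with null_iff[of A] posA show False by simp
qed

theorem proposition2p14:
  fixes \<alpha> :: real and E E1 E2 :: "(real ^ 'd) set"
  assumes "0 < \<alpha>" and "\<alpha> < 1"
    and "E1 \<in> sets lebesgue" and "E2 \<in> sets lebesgue"
    and "frac_perimeter \<alpha> E1 < \<infinity>" and "frac_perimeter \<alpha> E2 < \<infinity>"
    and "E = E1 \<union> E2"
    and "emeasure lebesgue (E1 \<inter> E2) = 0"
    and "emeasure lebesgue E1 > 0" and "emeasure lebesgue E2 > 0"
  shows "frac_perimeter \<alpha> E = frac_perimeter \<alpha> (E1 \<union> E2) \<and>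
    frac_perimeter \<alpha> (E1 \<union> E2) < frac_perimeter \<alpha> E1 + frac_perimeter \<alpha> E2"
proof -
  obtain A where A: "A \<in> sets borel" "AE x in lborel. x \<in> E1 \<longleftrightarrow> x \<in> A"
    using assms(3) by (rule lebesgue_set_AE_eq_borel)
  obtain B' where B': "B' \<in> sets borel" "AE x in lborel. x \<in> E2 \<longleftrightarrow> x \<in> B'"
    using assms(4) by (rule lebesgue_set_AE_eq_borel)
  \<comment> \<open>The part removed is null, since \<open>E1 \<inter> E2\<close> is.\<close>
  define B where "B = B' - A"
  have [measurable]: "A \<in> sets borel" "B \<in> sets borel"
    using A B' by (auto simp: B_def)
  have disj: "A \<inter> B = {}"
    by (auto simp: B_def)
  have "E1 \<inter> E2 \<in> null_sets lebesgue"
    using assms(3,4,8) by auto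
  then have "AE x in lborel. x \<notin> E1 \<inter> E2"
    using AE_not_in AE_completion_iff by blast
  then have B: "AE x in lborel. x \<in> E2 \<longleftrightarrow> x \<in> B"
    using A(2) B'(2) by eventually_elim (auto simp: B_def)
  have U: "AE x in lborel. x \<in> E1 \<union> E2 \<longleftrightarrow> x \<in> A \<union> B"
    using A(2) B by eventually_elim auto
  have eqs: "frac_perimeter \<alpha> E1 = frac_perimeter \<alpha> A" "frac_perimeter \<alpha> E2 = frac_perimeter \<alpha> B"
      "frac_perimeter \<alpha> (E1 \<union> E2) = frac_perimeter \<alpha> (A \<union> B)"
    using A(2) B U by (auto intro: frac_perimeter_cong_AE)
  have pos: "emeasure lborel T > 0"
    if "S \<in> sets lebesgue" "T \<in> sets borel" "AE x in lborel. x \<in> S \<longleftrightarrow> x \<in> T"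
      "emeasure lebesgue S > 0" for S T :: "(real ^ 'd) set"
  proof -
    have "emeasure lebesgue S = emeasure lebesgue T"
      using that by (intro emeasure_eq_AE) (auto simp: AE_completion_iff)
    with that show ?thesis by simp
  qed
  have int_pos: "2 * (frac_interaction \<alpha> A B + frac_interaction \<alpha> B A) > 0"
    using frac_interaction_pos[of A B \<alpha>] disj pos[OF assms(3) _ A(2) assms(9)]
      pos[OF assms(4) _ B assms(10)]
    by (simp add: ennreal_zero_less_mult_iff add_pos_nonneg)
  have split: "frac_perimeter \<alpha> E1 + frac_perimeter \<alpha> E2 =
      frac_perimeter \<alpha> (E1 \<union> E2) + 2 * (frac_interaction \<alpha> A B + frac_interaction \<alpha> B A)"
    unfolding eqs by (rule frac_perimeter_disjoint_Un) (use disj in auto)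
  have "frac_perimeter \<alpha> E1 + frac_perimeter \<alpha> E2 < top"
    using assms(5,6) by simp
  then have "frac_perimeter \<alpha> (E1 \<union> E2) < top"
    unfolding split by simp
  then have "frac_perimeter \<alpha> (E1 \<union> E2) < frac_perimeter \<alpha> E1 + frac_perimeter \<alpha> E2"
    unfolding split
    using int_pos ennreal_add_left_cancel_less[of "frac_perimeter \<alpha> (E1 \<union> E2)" 0]
    by (simp only: add_0_right) simp
  with assms(7) show ?thesis by simp
qed

end
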